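(* Every UQ ring $R$ is Dedekind finite, i.e. for all $a,b\in R$, $ab=1$ implies $ba=1$.
   Context: Rings are associative with identity, not necessarily commutative. $U(R)$ is the group of units of $R$. An element $a\in R$ is quasinilpotent if $1-ax\in U(R)$ for every $x\in R$ with $ax=xa$; $QN(R)$ is the set of quasinilpotent elements. A ring $R$ is UQ if $U(R)=1+QN(R)$. *)

theory Defs
  imports "HOL-Algebra.Ring"
begin

(* The locale ring demands neither commutativity nor \<one> \<noteq> \<zero>, so the zero ring is included. *)

definition quasinilpotent :: "('a, 'b) ring_scheme \<Rightarrow> 'a \<Rightarrow> bool" where
  "quasinilpotent R a \<longleftrightarrow>
     (\<forall>x\<in>carrier R. a \<otimes>\<^bsub>R\<^esub> x = x \<otimes>\<^bsub>R\<^esub> a \<longrightarrow> \<one>\<^bsub>R\<^esub> \<ominus>\<^bsub>R\<^esub> a \<otimes>\<^bsub>R\<^esub> x \<in> Units R)"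

definition QN :: "('a, 'b) ring_scheme \<Rightarrow> 'a set" where
  "QN R = {a \<in> carrier R. quasinilpotent R a}"

definition UQ :: "('a, 'b) ring_scheme \<Rightarrow> bool" where
  "UQ R \<longleftrightarrow> Units R = {\<one>\<^bsub>R\<^esub> \<oplus>\<^bsub>R\<^esub> q | q. q \<in> QN R}"

definition dedekind_finite :: "('a, 'b) ring_scheme \<Rightarrow> bool" where
  "dedekind_finite R \<longleftrightarrow>
     (\<forall>a\<in>carrier R. \<forall>b\<in>carrier R. a \<otimes>\<^bsub>R\<^esub> b = \<one>\<^bsub>R\<^esub> \<longrightarrow> b \<otimes>\<^bsub>R\<^esub> a = \<one>\<^bsub>R\<^esub>)"

end

theory Submission
  imports Defs
begin

text \<open>Suppose that \<open>a b = 1\<close> and put \<open>f = 1 - b a\<close>. The elements \<open>b\<^sup>i f a\<^sup>j\<close> with \<open>i, j < 2\<close> are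
  matrix units of a (possibly zero) \<open>2 \<times> 2\<close> matrix ring with identity \<open>e = f + b f a\<close>. The matrix
  \<open>v\<close> with rows \<open>(0, 1)\<close> and \<open>(1, 1)\<close> satisfies \<open>v\<^sup>2 = v + e\<close>, so \<open>v\<close> and \<open>v - e\<close> are inverse to each
  other relative to \<open>e\<close>. Hence \<open>1 + (v - e)\<close> is a unit of the ring, and in a UQ ring \<open>v - e\<close> is
  quasinilpotent. As \<open>v\<close> commutes with it, \<open>1 - (v - e) v = 1 - e\<close> is a unit; but it annihilates
  \<open>e\<close>, so \<open>e = 0\<close> and \<open>f = f e = 0\<close>.\<close>

context ring
begin

lemma UQ_Units_imp_QN:
  assumes "UQ R" and q: "q \<in> carrier R" and "\<one> \<oplus> q \<in> Units R"
  shows "q \<in> QN R"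
proof -
  obtain p where p: "p \<in> QN R" "\<one> \<oplus> q = \<one> \<oplus> p"
    using assms unfolding UQ_def by blast
  then have "q = p"
    using q by (simp add: QN_def)
  with p show ?thesis by simp
qed

text \<open>In the corner ring with identity \<open>e\<close>, \<open>v\<close> is a root of t^2 - t
  - 1, so \<open>v\<close> has inverse \<open>v \<ominus> e\<close> there.\<close>

lemma UQ_golden_element_imp_zero:
  assumes UQ: "UQ R" and e: "e \<in> carrier R" and v: "v \<in> carrier R"
    and ee: "e \<otimes> e = e" and ev: "e \<otimes> v = v" and ve: "v \<otimes> e = v" and vv: "v \<otimes> v = v \<oplus> e"
  shows "e = \<zero>"
proof -
  define q where "q = v \<ominus> e"
  define w where "w = \<one> \<ominus> e"
  have q: "q \<in> carrier R" and w: "w \<in> carrier R"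
    using e v by (auto simp: q_def w_def)
  have q_e: "q \<oplus> e = v"
    using e v by (simp add: q_def a_minus_def a_assoc l_neg)
  have w_e: "w \<oplus> e = \<one>"
    using e by (simp add: w_def a_minus_def a_assoc l_neg)
  have vq: "v \<otimes> q = e" and qv: "q \<otimes> v = e"
    using e v by (simp_all add: q_def a_minus_def r_distr l_distr r_minus l_minus vv ve ev
        a_comm[of v e] a_assoc r_neg)
  have we: "w \<otimes> e = \<zero>"
    using e by (simp add: w_def a_minus_def l_distr l_minus ee r_neg)
  have wv: "w \<otimes> v = \<zero>" and vw: "v \<otimes> w = \<zero>"
    using e v by (simp_all add: w_def a_minus_def l_distr r_distr l_minus r_minus ev ve r_neg)
  have wq: "w \<otimes> q = \<zero>" and qw: "q \<otimes> w = \<zero>"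
    using e v by (simp_all add: w_def q_def a_minus_def l_distr r_distr l_minus r_minus ev ve ee r_neg l_neg)
  have ww: "w \<otimes> w = w"
  proof -
    have "w \<otimes> (w \<oplus> e) = w \<otimes> w"
      using e w by (simp add: r_distr we)
    then show ?thesis using w by (simp add: w_e)
  qed
  have one_q: "\<one> \<oplus> q = v \<oplus> w"
    using e q w by (simp add: w_e[symmetric] q_e[symmetric] a_ac)
  \<comment> \<open>Peirce blocks: \<open>v\<close> and \<open>q\<close> are inverse in the corner
    of \<open>e\<close>, and \<open>w\<close> is the identity of the complementary corner.\<close>
  have "(v \<oplus> w) \<otimes> (q \<oplus> w) = \<one>" "(q \<oplus> w) \<otimes> (v \<oplus> w) = \<one>"
    using e v q w
    by (simp_all add: l_distr r_distr vq qv wv vw wq qw ww w_e a_comm[of e w])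
  then have "\<one> \<oplus> q \<in> Units R"
    unfolding one_q Units_def using v q w by blast
  then have "quasinilpotent R q"
    using UQ_Units_imp_QN[OF UQ q] by (simp add: QN_def)
  \<comment> \<open>Quasinilpotence of \<open>q\<close> is tested on \<open>v\<close>: both products
    are \<open>e\<close>, and \<open>\<one> \<ominus> e\<close> is \<open>w\<close>.\<close>
  then have "w \<in> Units R"
    using v vq qv unfolding quasinilpotent_def w_def by metis
  then show ?thesis
    using we e w Units_l_cancel[of w e \<zero>] by simp
qed

lemma UQ_imp_dedekind_finite:
  assumes UQ: "UQ R"
  shows "dedekind_finite R"
  unfolding dedekind_finite_def
proof (intro ballI impI)
  fix a b assume a: "a \<in> carrier R" and b: "b \<in> carrier R" and ab: "a \<otimes> b = \<one>"
  define f where "f = \<one> \<ominus> b \<otimes> a"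
  have f: "f \<in> carrier R"
    using a b by (simp add: f_def)
  have ab': "a \<otimes> (b \<otimes> x) = x" if "x \<in> carrier R" for x
    using a b that by (simp add: m_assoc[symmetric] ab)
  have af: "a \<otimes> f = \<zero>"
    using a b by (simp add: f_def a_minus_def r_distr r_minus ab' r_neg)
  have fb: "f \<otimes> b = \<zero>"
    using a b by (simp add: f_def a_minus_def l_distr l_minus m_assoc ab r_neg)
  have ff: "f \<otimes> f = f"
  proof -
    have "f \<otimes> f = (\<one> \<ominus> b \<otimes> a) \<otimes> f" by (simp add: f_def)
    also have "\<dots> = f"
      using a b f by (simp add: a_minus_def l_distr l_minus m_assoc af)
    finally show ?thesis .
  qed
  \<comment> \<open>The trailing factor \<open>x\<close> lets the relations fire inside products
    nested to the right.\<close>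
  have af': "a \<otimes> (f \<otimes> x) = \<zero>" and fb': "f \<otimes> (b \<otimes> x) = \<zero>" and ff': "f \<otimes> (f \<otimes> x) = f \<otimes> x"
    if "x \<in> carrier R" for x
    using a b f that by (simp_all add: m_assoc[symmetric] af fb ff)
  note rules = l_distr r_distr m_assoc ab ab' af af' fb fb' ff ff'
  define e where "e = f \<oplus> b \<otimes> (f \<otimes> a)"
  \<comment> \<open>The summands are the matrix units at positions (0,1), (1,0) and (1,1).\<close>
  define v where "v = f \<otimes> a \<oplus> (b \<otimes> f \<oplus> b \<otimes> (f \<otimes> a))"
  have "e \<in> carrier R" "v \<in> carrier R" "e \<otimes> e = e" "e \<otimes> v = v" "v \<otimes> e = v" "v \<otimes> v = v \<oplus> e"
    using a b f by (simp_all add: e_def v_def rules a_ac)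
  then have "e = \<zero>"
    by (rule UQ_golden_element_imp_zero[OF UQ])
  moreover have "f \<otimes> e = f"
    using a b f by (simp add: e_def rules)
  ultimately have "f = \<zero>"
    using f by simp
  moreover have "f \<oplus> b \<otimes> a = \<one>"
    using a b by (simp add: f_def a_minus_def a_assoc l_neg)
  ultimately show "b \<otimes> a = \<one>"
    using a b by simp
qed

end

theorem lemma3p7:
  fixes R :: "('a, 'b) ring_scheme"
  assumes "ring R" and "UQ R"
  shows "dedekind_finite R"
  using assms by (rule ring.UQ_imp_dedekind_finite)

end
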